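(* Let $r\geq 2$. Then, as formal power series in $q$ (with coefficients polynomial in $z_1,\dots,z_{r-1}$), \[ \sum \frac{1}{(q)_{n^{(1)}_1}} \prod_{i\geq 1} \Bigg( \prod_{j=1}^{r-1} z_j^{n^{(i)}_j-n^{(i)}_{j+1}} q^{n^{(i)}_j(n^{(i)}_j-n^{(i)}_{j+1})} \cdot {n^{(i)}_1 \brack n^{(i+1)}_1} \prod_{j=2}^{r-1} {n^{(i)}_1-n^{(i)}_{j+1}-n^{(i+1)}_1+n^{(i+1)}_j \brack n^{(i)}_j-n^{(i)}_{j+1}} \Bigg) =\prod_{j=1}^{r-1} \frac{1}{(z_jq;q)_{\infty}}, \] where the sum is over all families of nonnegative integers $n^{(i)}_j$ ($i\geq1$, $1\leq j\leq r-1$) with only finitely many nonzero terms, and $n^{(i)}_r:=0$ for all $i\geq1$.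
   Context: $(x;q)_\infty=\prod_{i\ge0}(1-xq^i)$, $(q)_n=(q;q)_n=\prod_{i=1}^n(1-q^i)$ for $n\geq 0$. For $n,m\in\mathbb{Z}$, ${n\brack m}=\frac{(q)_n}{(q)_m(q)_{n-m}}$ if $0\leq m\leq n$ and $0$ otherwise. For finitely supported families the product over $i$ has only finitely many factors different from $1$. *)

theory Defs
  imports "HOL-Analysis.Analysis" "HOL-Library.Poly_Mapping"
begin

text \<open>
  Formal power series in \<open>q\<close> are series of type \<open>_ fps\<close>, with \<open>q = fps_X\<close>.  Their coefficients are
  polynomials, represented as finitely supported functions on exponent vectors.  Infinite sums
  and products of series refer to the metric topology of \<^typ>\<open>'a fps\<close>, in which convergence means
  that every single coefficient is eventually constant.
\<close>

type_synonym 'a zpoly = "(nat \<Rightarrow>\<^sub>0 nat) \<Rightarrow>\<^sub>0 'a"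

definition zvar :: "nat \<Rightarrow> 'a::comm_ring_1 zpoly fps" where
  "zvar j = fps_const (Poly_Mapping.single (Poly_Mapping.single j 1) 1)"

text \<open>
  The class-based \<^const>\<open>inverse\<close> on series needs an inverse on the coefficients, which
  polynomials do not have.  For a series with constant coefficient \<open>1\<close> (the only case used below)
  the following is its multiplicative inverse.
\<close>

definition fps_recip :: "'b::comm_ring_1 fps \<Rightarrow> 'b fps" where
  "fps_recip F = fps_right_inverse F 1"

lemma fps_recip_inverse: "fps_nth F 0 = 1 \<Longrightarrow> F * fps_recip F = 1"
  unfolding fps_recip_def by (rule fps_right_inverse) simp

definition qpoch_inf :: "'b::comm_ring_1 fps \<Rightarrow> 'b fps" where
  "qpoch_inf x = prodinf (\<lambda>i. 1 - x * fps_X ^ i)"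

definition qfact :: "nat \<Rightarrow> 'b::comm_ring_1 fps" where
  "qfact n = (\<Prod>i=1..n. 1 - fps_X ^ i)"

definition qbinom :: "int \<Rightarrow> int \<Rightarrow> 'b::comm_ring_1 fps" where
  "qbinom n m =
     (if 0 \<le> m \<and> m \<le> n
      then qfact (nat n) * fps_recip (qfact (nat m) * qfact (nat (n - m)))
      else 0)"

text \<open>
  A family \<open>n\<close> has \<open>n i j\<close> in the role of the entry with upper index \<open>i\<close> and lower index \<open>j\<close>.
  It is extended by \<open>0\<close> outside \<open>i \<ge> 1\<close>, \<open>1 \<le> j \<le> r - 1\<close>; this includes the convention for
  the lower index \<open>r\<close>.
\<close>

definition families :: "nat \<Rightarrow> (nat \<Rightarrow> nat \<Rightarrow> nat) set" where
  "families r =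
     {n. (\<forall>i j. n i j \<noteq> 0 \<longrightarrow> 1 \<le> i \<and> 1 \<le> j \<and> j \<le> r - 1) \<and> finite {(i, j). n i j \<noteq> 0}}"

text \<open>
  The exponents of \<open>z\<close> and \<open>q\<close> use truncated subtraction.  This is harmless: as lemma
  \<open>summand_eq_0_if_negative\<close> below shows, if some difference is negative then the summand is \<open>0\<close>
  because one of its \<open>q\<close>-binomial coefficients vanishes.
\<close>

definition level_factor ::
    "nat \<Rightarrow> (nat \<Rightarrow> nat \<Rightarrow> nat) \<Rightarrow> nat \<Rightarrow> 'a::comm_ring_1 zpoly fps" where
  "level_factor r n i =
     (\<Prod>j=1..r-1. zvar j ^ (n i j - n i (j+1)) * fps_X ^ (n i j * (n i j - n i (j+1))))
     * qbinom (int (n i 1)) (int (n (i+1) 1))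
     * (\<Prod>j=2..r-1. qbinom (int (n i 1) - int (n i (j+1)) - int (n (i+1) 1) + int (n (i+1) j))
                           (int (n i j) - int (n i (j+1))))"

text \<open>
  The product over all \<open>i \<ge> 1\<close> is the product over the indices whose factor differs from \<open>1\<close>;
  these are finite in number by lemma \<open>finite_level_factors\<close> below.
\<close>

definition summand :: "nat \<Rightarrow> (nat \<Rightarrow> nat \<Rightarrow> nat) \<Rightarrow> 'a::comm_ring_1 zpoly fps" where
  "summand r n =
     fps_recip (qfact (n 1 1)) * (\<Prod>i\<in>{i. 1 \<le> i \<and> level_factor r n i \<noteq> (1 :: 'a zpoly fps)}. level_factor r n i)"

lemma qbinom_0_0: "qbinom 0 0 = (1 :: 'b::comm_ring_1 fps)"
proof -
  have "(1 :: 'b fps) * fps_recip 1 = 1"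
    by (rule fps_recip_inverse) simp
  then show ?thesis
    by (simp add: qbinom_def qfact_def)
qed

lemma families_bound:
  assumes "n \<in> families r"
  obtains N where "\<And>i j. N \<le> i \<Longrightarrow> n i j = 0"
proof -
  have "finite (fst ` {(i, j). n i j \<noteq> 0})"
    using assms by (auto simp: families_def)
  then obtain N where N: "\<forall>i \<in> fst ` {(i, j). n i j \<noteq> 0}. i < N"
    using finite_nat_set_iff_bounded by blast
  have "n i j = 0" if "N \<le> i" for i j
  proof (rule ccontr)
    assume "n i j \<noteq> 0"
    then have "i \<in> fst ` {(i, j). n i j \<noteq> 0}"
      by force
    with N that show False
      by auto
  qed
  then show thesis
    by (rule that)
qed

lemma finite_level_factors:
  assumes "n \<in> families r"
  shows "finite {i. 1 \<le> i \<and> level_factor r n i \<noteq> (1 :: 'a::comm_ring_1 zpoly fps)}"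
proof -
  obtain N where N: "\<And>i j. N \<le> i \<Longrightarrow> n i j = 0"
    using families_bound[OF assms] by blast
  have "level_factor r n i = (1 :: 'a zpoly fps)" if "N \<le> i" for i
    using N that by (simp add: level_factor_def qbinom_0_0)
  then have "{i. 1 \<le> i \<and> level_factor r n i \<noteq> (1 :: 'a zpoly fps)} \<subseteq> {..<N}"
    by (auto simp: not_le[symmetric])
  then show ?thesis
    using finite_subset by blast
qed

lemma summand_eq_0_if_negative:
  assumes n: "n \<in> families r" and "1 \<le> i" and "1 \<le> j" and "j \<le> r - 1"
    and less: "n i j < n i (j+1)"
  shows "summand r n = (0 :: 'a::comm_ring_1 zpoly fps)"
proof (rule ccontr)
  assume nz: "summand r n \<noteq> (0 :: 'a zpoly fps)"
  have level_nz: "level_factor r n k \<noteq> (0 :: 'a zpoly fps)" if "1 \<le> k" for k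
  proof
    assume 0: "level_factor r n k = (0 :: 'a zpoly fps)"
    have "(\<Prod>i\<in>{i. 1 \<le> i \<and> level_factor r n i \<noteq> (1 :: 'a zpoly fps)}. level_factor r n i) = (0 :: 'a zpoly fps)"
      by (rule prod_zero[OF finite_level_factors[OF n]]) (use 0 that in force)
    with nz show False
      by (simp add: summand_def)
  qed
  have binom: "n k (l+1) \<le> n k l"
       "int (n k l) - int (n k (l+1))
        \<le> int (n k 1) - int (n k (l+1)) - int (n (k+1) 1) + int (n (k+1) l)"
    if "1 \<le> k" "2 \<le> l" "l \<le> r - 1" for k l
  proof -
    have "qbinom (int (n k 1) - int (n k (l+1)) - int (n (k+1) 1) + int (n (k+1) l))
                 (int (n k l) - int (n k (l+1))) \<noteq> (0 :: 'a zpoly fps)"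
    proof
      assume 0: "qbinom (int (n k 1) - int (n k (l+1)) - int (n (k+1) 1) + int (n (k+1) l))
                 (int (n k l) - int (n k (l+1))) = (0 :: 'a zpoly fps)"
      have "(\<Prod>j=2..r-1. qbinom (int (n k 1) - int (n k (j+1)) - int (n (k+1) 1) + int (n (k+1) j))
                           (int (n k j) - int (n k (j+1)))) = (0 :: 'a zpoly fps)"
        by (rule prod_zero) (use 0 that in auto)
      with level_nz[OF \<open>1 \<le> k\<close>] show False
        by (simp add: level_factor_def)
    qed
    then show "n k (l+1) \<le> n k l"
       "int (n k l) - int (n k (l+1))
        \<le> int (n k 1) - int (n k (l+1)) - int (n (k+1) 1) + int (n (k+1) l)"
      by (auto simp: qbinom_def split: if_splits)
  qed
  show False
  proof (cases "j = 1")
    case False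
    with binom(1)[of i j] assms show False
      by auto
  next
    case True
    with less have "n i 2 \<noteq> 0"
      by (auto simp: numeral_2_eq_2)
    then have r: "2 \<le> r - 1"
      using n by (auto simp: families_def)
    obtain N where N: "\<And>i j. N \<le> i \<Longrightarrow> n i j = 0"
      using families_bound[OF n] by blast
    have "n (i + d) 1 < n (i + d) 2" for d
    proof (induction d)
      case 0
      then show ?case
        using less True by (simp add: numeral_2_eq_2)
    next
      case (Suc d)
      with binom(2)[of "i + d" 2] r \<open>1 \<le> i\<close> show ?case
        by simp
    qed
    from this[of N] N[of "i + N"] show False
      by simp
  qed
qed

end

theory Submission
  imports Defs
begin

text \<open>
  Write \<open>A\<^sub>j = n\<^sub>1 - n\<^bsub>j+1\<^esub>\<close> and \<open>B\<^sub>j = m\<^sub>1 - m\<^bsub>j+1\<^esub>\<close> for two consecutive levels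
  \<open>n\<close> and \<open>m\<close>.  Up to multinomial coefficients \<open>M(n)\<close> and \<open>M(m)\<close>, the binomial factors linking the two
  levels are \<open>\<Prod>\<^sub>j [A\<^sub>j - B\<^bsub>j-1\<^esub>, B\<^sub>j - B\<^bsub>j-1\<^esub>]\<close>, and the exponent of \<open>q\<close> is
  \<open>\<Sum>\<^sub>j B\<^sub>j (B\<^sub>j - B\<^bsub>j-1\<^esub>)\<close>.  Hence the sum over \<open>m\<close> can be carried out column by column, from the
  last to the first, with the Durfee rectangle identity
  \<open>\<Sum>\<^sub>b [A - c, b] x\<^sup>b q\<^bsup>b(b+c)\<^esup> / (xq)\<^bsub>b+c\<^esub> = 1/(xq)\<^sub>A\<close>.  This shows that
  \<open>H(n) = M(n) \<Prod>\<^sub>j 1/(z\<^sub>j q)\<^bsub>A\<^sub>j\<^esub>\<close> is fixed by the transfer operator that passes from one level to the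
  next.  Iterating from the row \<open>(N, 0, \<dots>, 0)\<close>, at which \<open>H\<close> is \<open>\<Prod>\<^sub>j 1/(z\<^sub>j q)\<^sub>N\<close>, gives the
  theorem modulo \<open>q\<^bsup>N+1\<^esup>\<close>.
\<close>

subsection \<open>Finite Durfee identities\<close>

lemma fps_X_power_dvd_iff:
  fixes F :: "'b::comm_ring_1 fps"
  shows "fps_X ^ n dvd F \<longleftrightarrow> (\<forall>k<n. fps_nth F k = 0)"
proof
  assume "fps_X ^ n dvd F"
  then show "\<forall>k<n. fps_nth F k = 0"
    by (auto simp: dvd_def fps_X_power_mult_nth)
next
  assume "\<forall>k<n. fps_nth F k = 0"
  then have "fps_cutoff n F = 0"
    by (simp add: fps_eq_iff)
  then have "F = fps_X ^ n * fps_shift n F"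
    using fps_shift_cutoff'[of n F] by simp
  then show "fps_X ^ n dvd F"
    by (rule dvdI)
qed

lemma fps_nth_0_mult: "fps_nth (F * G) 0 = fps_nth F 0 * fps_nth G (0 :: nat)"
  by (simp add: fps_mult_nth)

lemma fps_nth_0_prod_eq_1:
  fixes f :: "'i \<Rightarrow> 'b::comm_ring_1 fps"
  shows "(\<And>i. i \<in> I \<Longrightarrow> fps_nth (f i) 0 = 1) \<Longrightarrow> fps_nth (prod f I) 0 = 1"
  by (induction I rule: infinite_finite_induct) (auto simp: fps_nth_0_mult)

lemma fps_recip_unique:
  fixes F G :: "'b::comm_ring_1 fps"
  assumes "F * G = 1" "fps_nth F 0 = 1"
  shows "fps_recip F = G"
  using fps_recip_inverse[OF assms(2)] assms(1) by (metis mult.assoc mult.commute mult_1)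

lemma fps_recip_nth_0 [simp]: "fps_nth (fps_recip F) 0 = 1"
  by (simp add: fps_recip_def)

lemma fps_recip_1 [simp]: "fps_recip 1 = (1 :: 'b::comm_ring_1 fps)"
  by (rule fps_recip_unique) auto

lemma fps_recip_mult:
  fixes F G :: "'b::comm_ring_1 fps"
  assumes "fps_nth F 0 = 1" "fps_nth G 0 = 1"
  shows "fps_recip (F * G) = fps_recip F * fps_recip G"
proof (rule fps_recip_unique)
  show "F * G * (fps_recip F * fps_recip G) = 1"
    using fps_recip_inverse[OF assms(1)] fps_recip_inverse[OF assms(2)]
    by (metis mult.assoc mult.left_commute mult_1_right)
qed (use assms in \<open>simp add: fps_nth_0_mult\<close>)

text \<open>Carries a congruence between two denominators over to their reciprocals.\<close>

lemma fps_recip_diff: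
  fixes F G :: "'b::comm_ring_1 fps"
  assumes "fps_nth F 0 = 1" "fps_nth G 0 = 1"
  shows "fps_recip F - fps_recip G = fps_recip F * fps_recip G * (G - F)"
proof -
  have "fps_recip F * fps_recip G * (G - F) =
      fps_recip F * (G * fps_recip G) - (F * fps_recip F) * fps_recip G"
    by (simp add: algebra_simps)
  then show ?thesis
    using assms by (simp add: fps_recip_inverse)
qed

section \<open>q-Pochhammer symbols and q-binomial coefficients\<close>

text \<open>This is \<open>(xq;q)_n\<close>: exponents start at 1, so \<open>x = z_j\<close> gives
  truncations of the denominators in the theorem and \<open>x = 1\<close> gives
  \<open>qfact\<close>.\<close>

definition qpoch :: "'b::comm_ring_1 fps \<Rightarrow> nat \<Rightarrow> 'b fps" where
  "qpoch x n = (\<Prod>i=1..n. 1 - x * fps_X ^ i)"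

lemma qpoch_0 [simp]: "qpoch x 0 = 1"
  by (simp add: qpoch_def)

lemma qpoch_nth_0 [simp]: "fps_nth (qpoch x n) 0 = 1"
  unfolding qpoch_def by (rule fps_nth_0_prod_eq_1) (simp add: fps_nth_0_mult)

lemma qpoch_Suc: "qpoch x (Suc n) = qpoch x n * (1 - x * fps_X ^ Suc n)"
  by (simp add: qpoch_def)

lemma qpoch_add: "qpoch x (m + n) = qpoch x m * qpoch (x * fps_X ^ m) n"
  by (induction n) (simp_all add: qpoch_Suc power_add algebra_simps)

lemma qfact_nth_0 [simp]: "fps_nth (qfact n) 0 = (1 :: 'b::comm_ring_1)"
  unfolding qfact_def by (rule fps_nth_0_prod_eq_1) simp

lemma qfact_0 [simp]: "qfact 0 = 1"
  by (simp add: qfact_def)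

lemma qfact_Suc: "qfact (Suc n) = qfact n * (1 - fps_X ^ Suc n)"
  by (simp add: qfact_def)

definition rfact :: "nat \<Rightarrow> 'b::comm_ring_1 fps" where
  "rfact n = fps_recip (qfact n)"

lemma rfact_0 [simp]: "rfact 0 = 1"
  by (simp add: rfact_def)

lemma qfact_mult_rfact: "qfact n * rfact n = (1 :: 'b::comm_ring_1 fps)"
  by (simp add: rfact_def fps_recip_inverse)

lemma rfact_Suc: "rfact n = (1 - fps_X ^ Suc n) * (rfact (Suc n) :: 'b::comm_ring_1 fps)"
  unfolding rfact_def
  by (rule fps_recip_unique)
     (use fps_recip_inverse[of "qfact (Suc n) :: 'b fps"] in \<open>auto simp: qfact_Suc mult.assoc\<close>)

lemma qbinom_of_nat:
  "qbinom (int n) (int m) =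
    (if m \<le> n then qfact n * rfact m * rfact (n - m) else (0 :: 'b::comm_ring_1 fps))"
  by (auto simp: qbinom_def rfact_def fps_recip_mult mult.assoc nat_diff_distrib)

lemma qbinom_0_right: "qbinom (int n) 0 = (1 :: 'b::comm_ring_1 fps)"
  using qbinom_of_nat[of n 0, where 'b = 'b] by (simp add: qfact_mult_rfact)

lemma qbinom_Suc_Suc:
  "qbinom (int (Suc n)) (int (Suc m)) =
     qbinom (int n) (int m) + fps_X ^ Suc m * (qbinom (int n) (int (Suc m)) :: 'b::comm_ring_1 fps)"
proof (cases "m < n")
  case True
  then obtain d where n: "n = Suc (m + d)"
    using less_imp_Suc_add by blast
  \<comment> \<open>Over a common denominator this reads
    \<open>(1 - q^(m+1)) + q^(m+1) (1 - q^(d+1)) = 1 - q^(m+d+2)\<close>.\<close>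
  have "rfact (Suc d) * rfact m + fps_X ^ Suc m * (rfact (Suc m) * rfact d) =
        (rfact (Suc d) * rfact (Suc m) * (1 - fps_X ^ Suc n) :: 'b fps)"
    unfolding rfact_Suc[of m] rfact_Suc[of d] n
    by (simp add: algebra_simps power_add)
  then have "qfact n * (rfact (Suc d) * rfact m + fps_X ^ Suc m * (rfact (Suc m) * rfact d)) =
        (qfact (Suc n) * rfact (Suc d) * rfact (Suc m) :: 'b fps)"
    by (simp only: qfact_Suc ac_simps)
  then show ?thesis
    using True unfolding qbinom_of_nat by (simp add: n algebra_simps Suc_diff_le del: power_Suc)
next
  case False
  then show ?thesis
    unfolding qbinom_of_nat by (auto simp: not_less le_Suc_eq qfact_mult_rfact)
qed

text \<open>
  The Pascal rule splits the sum in two; writing \<open>1/(xq)\<^sub>m\<close> in terms of \<open>1/(xq\<^sup>2)\<^sub>m\<close>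
  recombines the two halves into \<open>1/(1-xq)\<close> times the sum for \<open>n\<close> with \<open>x\<close> replaced by \<open>xq\<close>.
\<close>
lemma finite_durfee:
  fixes x :: "'b::comm_ring_1 fps"
  shows "(\<Sum>m\<le>n. qbinom (int n) (int m) * x ^ m * fps_X ^ (m * m) * fps_recip (qpoch x m)) =
    fps_recip (qpoch x n)"
proof (induction n arbitrary: x)
  case 0
  then show ?case by (simp add: qbinom_0_0)
next
  case (Suc n)
  define y where "y = x * fps_X"
  define c where "c = fps_recip (1 - y)"
  have y0: "fps_nth (1 - y) 0 = 1"
    by (simp add: y_def)
  have qx: "qpoch x (Suc m) = (1 - y) * qpoch y m" for m
    using qpoch_add[of x 1 m] by (simp add: y_def qpoch_def)
  have rx: "fps_recip (qpoch x (Suc m)) = c * fps_recip (qpoch y m)" for m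
    unfolding qx c_def by (rule fps_recip_mult[OF y0 qpoch_nth_0])
  \<comment> \<open>Inverts
    \<open>(xq)_m (1 - xq^(m+1)) = (xq)_(m+1) = (1 - xq) (xq^2)_m\<close>.\<close>
  have rx': "fps_recip (qpoch x m) = c * fps_recip (qpoch y m) * (1 - y * fps_X ^ m)" for m
  proof (rule fps_recip_unique)
    have "qpoch x m * (1 - y * fps_X ^ m) = (1 - y) * qpoch y m"
      using qx[of m] by (simp add: qpoch_Suc y_def mult.assoc)
    moreover have "qpoch x m * (c * fps_recip (qpoch y m) * (1 - y * fps_X ^ m)) =
       qpoch x m * (1 - y * fps_X ^ m) * (c * fps_recip (qpoch y m))"
      by (simp only: ac_simps)
    ultimately have "qpoch x m * (c * fps_recip (qpoch y m) * (1 - y * fps_X ^ m)) =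
       ((1 - y) * c) * (qpoch y m * fps_recip (qpoch y m))"
      by (simp only: ac_simps)
    then show "qpoch x m * (c * fps_recip (qpoch y m) * (1 - y * fps_X ^ m)) = 1"
      using y0 by (simp add: c_def fps_recip_inverse)
  qed simp
  define t where "t m = qbinom (int n) (int m) * y ^ m * fps_X ^ (m * m) * fps_recip (qpoch y m)" for m
  define f where "f m = x ^ m * fps_X ^ (m * m) * fps_recip (qpoch x m)" for m
  \<comment> \<open>The two halves put the weights \<open>1 - y q^m\<close> and \<open>y q^m\<close>
    on the same term \<open>c * t m\<close>, so together they give \<open>c * t m\<close>.\<close>
  have lo: "fps_X ^ m * qbinom (int n) (int m) * f m = c * t m * (1 - y * fps_X ^ m)" for m
    unfolding f_def t_def rx' by (simp add: y_def power_mult_distrib algebra_simps)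
  have hi: "qbinom (int n) (int m) * f (Suc m) = c * t m * (y * fps_X ^ m)" for m
    unfolding f_def t_def rx
    by (simp add: y_def power_mult_distrib power_add algebra_simps)
  have "(\<Sum>m\<le>Suc n. qbinom (int (Suc n)) (int m) * f m) =
      f 0 + (\<Sum>m\<le>n. qbinom (int (Suc n)) (int (Suc m)) * f (Suc m))"
    using qbinom_0_right[of "Suc n", where 'b = 'b] by (subst sum.atMost_Suc_shift) simp
  also have "\<dots> = (f 0 + (\<Sum>m\<le>n. fps_X ^ Suc m * qbinom (int n) (int (Suc m)) * f (Suc m)))
       + (\<Sum>m\<le>n. qbinom (int n) (int m) * f (Suc m))"
    unfolding qbinom_Suc_Suc by (simp add: sum.distrib algebra_simps)
  also have "f 0 + (\<Sum>m\<le>n. fps_X ^ Suc m * qbinom (int n) (int (Suc m)) * f (Suc m)) =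
      (\<Sum>m\<le>Suc n. fps_X ^ m * qbinom (int n) (int m) * f m)"
    using qbinom_0_right[of n, where 'b = 'b] by (subst sum.atMost_Suc_shift) simp
  also have "\<dots> = (\<Sum>m\<le>n. fps_X ^ m * qbinom (int n) (int m) * f m)"
    using qbinom_of_nat[of n "Suc n", where 'b = 'b] by simp
  also have "\<dots> + (\<Sum>m\<le>n. qbinom (int n) (int m) * f (Suc m)) = c * (\<Sum>m\<le>n. t m)"
    unfolding lo hi by (simp add: sum_distrib_left algebra_simps flip: sum.distrib)
  also have "(\<Sum>m\<le>n. t m) = fps_recip (qpoch y n)"
    unfolding t_def by (rule Suc.IH)
  finally show ?case
    by (simp add: f_def rx mult.assoc)
qed

text \<open>Shifting the index by \<open>c\<close> and splitting
  \<open>(xq)_(m+c) = (xq)_c (xq^(c+1))_m\<close> reduces this to \<open>finite_durfee\<close> for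
  \<open>x q^c\<close>.\<close>

lemma shifted_durfee:
  fixes x :: "'b::comm_ring_1 fps"
  assumes "c \<le> A"
  shows "(\<Sum>d=c..A. x ^ (d - c) * fps_X ^ (d * (d - c)) * qbinom (int (A - c)) (int (d - c)) *
           fps_recip (qpoch x d)) = fps_recip (qpoch x A)"
proof -
  define y where "y = x * fps_X ^ c"
  have q: "fps_recip (qpoch x (m + c)) = fps_recip (qpoch x c) * fps_recip (qpoch y m)" for m
    using qpoch_add[of x c m] by (simp add: y_def fps_recip_mult add.commute)
  have "(\<Sum>d=c..A. x ^ (d - c) * fps_X ^ (d * (d - c)) * qbinom (int (A - c)) (int (d - c)) *
           fps_recip (qpoch x d)) =
        (\<Sum>m=0..A-c. x ^ m * fps_X ^ ((m + c) * m) * qbinom (int (A - c)) (int m) *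
           fps_recip (qpoch x (m + c)))"
    using sum.shift_bounds_cl_nat_ivl[where m = 0 and n = "A - c" and k = c] assms
    by (metis (no_types, lifting) ext add_0 add_diff_cancel_right' le_add_diff_inverse2) 
  also have "\<dots> = fps_recip (qpoch x c) * 
     (\<Sum>m\<le>A-c. qbinom (int (A - c)) (int m) * y ^ m * fps_X ^ (m * m) * fps_recip (qpoch y m))"
    unfolding q sum_distrib_left atLeast0AtMost
    by (intro sum.cong) (simp_all add: y_def power_mult_distrib power_add algebra_simps flip: power_mult)
  also have "\<dots> = fps_recip (qpoch x (A - c + c))"
    unfolding finite_durfee q ..
  finally show ?thesis
    using assms by simp
qed


subsection \<open>The transfer operator between levels\<close>

text \<open>The default \<open>d\<close> beyond \<open>L\<close> makes a path determined by its
  first \<open>L + 1\<close> values. Paths serve twice: numbers across the columns of one row, and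
  rows down the levels of a family.\<close>

definition chains :: "(nat \<Rightarrow> 'a set) \<Rightarrow> 'a \<Rightarrow> nat \<Rightarrow> (nat \<Rightarrow> 'a) set" where
  "chains X d L = {f. (\<forall>i\<le>L. f i \<in> X i) \<and> (\<forall>i>L. f i = d)}"

lemma sum_chains_0: "sum F (chains X d 0) = (\<Sum>y\<in>X 0. F (\<lambda>i. if i = 0 then y else d))"
  by (rule sum.reindex_bij_witness[where j = "\<lambda>f. f 0" and i = "\<lambda>y i. if i = 0 then y else d"])
     (auto simp: chains_def fun_eq_iff intro!: arg_cong[where f = F])

lemma sum_chains_Suc:
  "sum F (chains X d (Suc L)) = (\<Sum>f\<in>chains X d L. \<Sum>x\<in>X (Suc L). F (f(Suc L := x)))"
  unfolding sum.cartesian_product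
  by (rule sum.reindex_bij_witness[where j = "\<lambda>f. (f(Suc L := d), f (Suc L))"
        and i = "\<lambda>(f, x). f(Suc L := x)"])
     (auto simp: chains_def fun_eq_iff le_Suc_eq)

lemma finite_chains: "(\<And>i. i \<le> L \<Longrightarrow> finite (X i)) \<Longrightarrow> finite (chains X d L)"
proof (induction L)
  case 0
  have "chains X d 0 \<subseteq> (\<lambda>y i. if i = 0 then y else d) ` X 0"
    by (auto simp: chains_def fun_eq_iff image_iff)
  then show ?case
    using 0 finite_subset by blast
next
  case (Suc L)
  have "chains X d (Suc L) \<subseteq> (\<lambda>(f, x). f(Suc L := x)) ` (chains X d L \<times> X (Suc L))"
  proof
    fix f assume "f \<in> chains X d (Suc L)"
    then have "(f(Suc L := d), f (Suc L)) \<in> chains X d L \<times> X (Suc L)"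
      by (auto simp: chains_def)
    then show "f \<in> (\<lambda>(f, x). f(Suc L := x)) ` (chains X d L \<times> X (Suc L))"
      by (rule rev_image_eqI) simp
  qed
  then show ?case
    using Suc finite_subset by (metis (no_types, lifting) finite_SigmaI finite_imageI le_Suc_eq)
qed

text \<open>The last entry is summed out first; each inner sum collapses to \<open>h\<close> one
  level earlier, until only the start of the path remains.\<close>

lemma sum_chains_telescope:
  fixes h :: "nat \<Rightarrow> 'a \<Rightarrow> 'b::comm_ring_1"
  assumes "\<And>i y. i < L \<Longrightarrow> y \<in> X i \<Longrightarrow> (\<Sum>x\<in>X (Suc i). g i y x * h (Suc i) x) = h i y"
  shows "(\<Sum>f\<in>chains X d L. (\<Prod>i<L. g i (f i) (f (Suc i))) * h L (f L)) = (\<Sum>y\<in>X 0. h 0 y)"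
  using assms
proof (induction L)
  case 0
  then show ?case by (simp add: sum_chains_0)
next
  case (Suc L)
  have "(\<Sum>f\<in>chains X d (Suc L). (\<Prod>i<Suc L. g i (f i) (f (Suc i))) * h (Suc L) (f (Suc L))) =
     (\<Sum>f\<in>chains X d L. \<Sum>x\<in>X (Suc L). (\<Prod>i<L. g i (f i) (f (Suc i))) * (g L (f L) x * h (Suc L) x))"
    unfolding sum_chains_Suc by (intro sum.cong) (simp_all add: mult.assoc)
  also have "\<dots> = (\<Sum>f\<in>chains X d L. (\<Prod>i<L. g i (f i) (f (Suc i))) * h L (f L))"
    by (intro sum.cong) (auto simp: Suc.prems chains_def simp flip: sum_distrib_left)
  also have "\<dots> = (\<Sum>y\<in>X 0. h 0 y)"
    using Suc by simp
  finally show ?case .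
qed

section \<open>Summation column by column\<close>

text \<open>The summand of \<open>shifted_durfee\<close> for consecutive gaps \<open>c\<close> and
  \<open>d\<close>. The explicit 0 for \<open>d < c\<close> is needed because truncated subtraction
  would read \<open>d - c\<close> as 0.\<close>

definition column_factor :: "(nat \<Rightarrow> 'b::comm_ring_1 fps) \<Rightarrow> (nat \<Rightarrow> nat) \<Rightarrow> nat \<Rightarrow> nat \<Rightarrow> nat \<Rightarrow> 'b fps" where
  "column_factor z A j c d =
     (if c \<le> d then z (Suc j) ^ (d - c) * fps_X ^ (d * (d - c)) *
        qbinom (int (A (Suc j) - c)) (int (d - c)) * fps_recip (qpoch (z (Suc j)) d) else 0)"

lemma sum_column_chains:
  fixes z :: "nat \<Rightarrow> 'b::comm_ring_1 fps"
  assumes "A 0 = 0" and mono: "\<And>j. j < s \<Longrightarrow> A j \<le> A (Suc j)"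
  shows "(\<Sum>B\<in>chains (\<lambda>j. {..A j}) 0 s. \<Prod>j<s. column_factor z A j (B j) (B (Suc j))) =
    (\<Prod>j<s. fps_recip (qpoch (z (Suc j)) (A (Suc j))))"
proof -
  \<comment> \<open>The product of the column values still to come. It is constant in
    \<open>c\<close> because the value in \<open>shifted_durfee\<close> is, so the columns
    decouple.\<close>
  define h where "h i (c::nat) = (\<Prod>j\<in>{i..<s}. fps_recip (qpoch (z (Suc j)) (A (Suc j))))" for i c
  have "(\<Sum>d\<in>{..A (Suc i)}. column_factor z A i c d * h (Suc i) d) = h i c"
    if "i < s" "c \<in> {..A i}" for i c
  proof -
    have c: "c \<le> A (Suc i)"
      using mono[OF \<open>i < s\<close>] that by simp
    have "(\<Sum>d\<in>{..A (Suc i)}. column_factor z A i c d * h (Suc i) d) =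
        (\<Sum>d=c..A (Suc i). column_factor z A i c d) * h (Suc i) c"
      unfolding sum_distrib_right
      by (rule sum.mono_neutral_cong_right) (auto simp: column_factor_def h_def)
    also have "(\<Sum>d=c..A (Suc i). column_factor z A i c d) =
        fps_recip (qpoch (z (Suc i)) (A (Suc i)))"
      unfolding shifted_durfee[OF c, symmetric]
      by (rule sum.cong) (auto simp: column_factor_def)
    also have "\<dots> * h (Suc i) c = h i c"
      using \<open>i < s\<close> by (simp add: h_def prod.atLeast_Suc_lessThan)
    finally show ?thesis .
  qed
  then have "(\<Sum>B\<in>chains (\<lambda>j. {..A j}) 0 s.
      (\<Prod>j<s. column_factor z A j (B j) (B (Suc j))) * h s (B s)) = (\<Sum>c\<in>{..A 0}. h 0 c)"
    by (rule sum_chains_telescope)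
  then show ?thesis
    by (simp add: h_def \<open>A 0 = 0\<close> atLeast0LessThan)
qed

section \<open>Rows, their gaps, and the kernel in gap coordinates\<close>

text \<open>Partitions with at most \<open>s\<close> parts, all at most \<open>N\<close>. Here
  \<open>s\<close> stands for \<open>r - 1\<close>, and the zeros beyond \<open>s\<close> contain
  the convention for the lower index \<open>r\<close>.\<close>

definition rows :: "nat \<Rightarrow> nat \<Rightarrow> (nat \<Rightarrow> nat) set" where
  "rows s N = {m. m 0 = 0 \<and> (\<forall>j>s. m j = 0) \<and> (\<forall>j\<ge>1. m (Suc j) \<le> m j) \<and> m 1 \<le> N}"

text \<open>The \<open>A_j\<close> and \<open>B_j\<close> of the overview. For a row they increase
  from 0 at \<open>j = 0\<close> to \<open>m 1\<close> at \<open>j = s\<close>.\<close>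

definition gap :: "(nat \<Rightarrow> nat) \<Rightarrow> nat \<Rightarrow> nat" where
  "gap m j = m 1 - m (Suc j)"

text \<open>\<open>level_factor\<close> is split into this weight of a single row and the kernel
  below, which links two consecutive rows.\<close>

definition row_weight :: "nat \<Rightarrow> (nat \<Rightarrow> 'b::comm_ring_1 fps) \<Rightarrow> (nat \<Rightarrow> nat) \<Rightarrow> 'b fps" where
  "row_weight s z m = (\<Prod>j=1..s. z j ^ (m j - m (j+1)) * fps_X ^ (m j * (m j - m (j+1))))"

definition row_kernel :: "nat \<Rightarrow> (nat \<Rightarrow> nat) \<Rightarrow> (nat \<Rightarrow> nat) \<Rightarrow> 'b::comm_ring_1 fps" where
  "row_kernel s n m = qbinom (int (n 1)) (int (m 1)) *
     (\<Prod>j=2..s. qbinom (int (n 1) - int (n (j+1)) - int (m 1) + int (m j)) (int (n j) - int (n (j+1))))"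

text \<open>For a row, the q-multinomial coefficient of \<open>n 1\<close> over the steps
  \<open>n j - n (j+1)\<close>, the \<open>M(n)\<close> of the overview.\<close>

definition row_multinom :: "nat \<Rightarrow> (nat \<Rightarrow> nat) \<Rightarrow> 'b::comm_ring_1 fps" where
  "row_multinom s n = qfact (n 1) * (\<Prod>j<s. rfact (gap n (Suc j) - gap n j))"

text \<open>The function \<open>H\<close> fixed by the transfer operator.\<close>

definition row_total :: "nat \<Rightarrow> (nat \<Rightarrow> 'b::comm_ring_1 fps) \<Rightarrow> (nat \<Rightarrow> nat) \<Rightarrow> 'b fps" where
  "row_total s z n = row_multinom s n * (\<Prod>j<s. fps_recip (qpoch (z (Suc j)) (gap n (Suc j))))"

lemma row_le_first:
  assumes "m \<in> rows s N"
  shows "m j \<le> m 1"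
proof (cases j)
  case (Suc i)
  have "m (Suc i) \<le> m 1"
    by (induction i) (use assms in \<open>auto simp: rows_def intro: order_trans\<close>)
  with Suc show ?thesis by simp
qed (use assms in \<open>simp add: rows_def\<close>)

lemma row_decreasing: "m \<in> rows s N \<Longrightarrow> m (Suc (Suc j)) \<le> m (Suc j)"
  by (simp add: rows_def)

lemma gap_0 [simp]: "gap m 0 = 0"
  by (simp add: gap_def)

lemma gap_eq: "m \<in> rows s N \<Longrightarrow> m (Suc j) = m 1 - gap m j"
  using row_le_first[of m s N "Suc j"] by (simp add: gap_def)

lemma gap_last: "m \<in> rows s N \<Longrightarrow> gap m s = m 1"
  by (simp add: gap_def rows_def)

lemma gap_mono: "m \<in> rows s N \<Longrightarrow> gap m j \<le> gap m (Suc j)"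
  by (simp add: gap_def rows_def diff_le_mono2)

lemma gap_Suc_diff: "m \<in> rows s N \<Longrightarrow> gap m (Suc j) - gap m j = m (Suc j) - m (Suc (Suc j))"
  using row_le_first[of m s N "Suc j"] row_le_first[of m s N "Suc (Suc j)"]
  by (simp add: gap_def)

lemma gap_le_first: "gap m j \<le> m 1"
  by (simp add: gap_def)

lemma prod_two_shift: "(\<Prod>j=2..Suc t. F j) = (\<Prod>i<t. F (Suc (Suc i)))"
  by (induction t) (simp_all add: prod.nat_ivl_Suc' mult.commute)

text \<open>With \<open>A = gap n\<close> and \<open>B = gap m\<close>, the factor of index
  \<open>j\<close> becomes \<open>[A_j - B_(j-1), A_j - A_(j-1)]\<close>, where
  \<open>j = i + 2\<close>; the leading factor uses \<open>n 1 = A_s\<close> and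
  \<open>m 1 = B_s\<close>.\<close>

lemma row_kernel_gap:
  assumes n: "n \<in> rows s N" and m: "m \<in> rows s N'" and s: "s = Suc t"
  shows "row_kernel s n m = qbinom (int (gap n s)) (int (gap m s)) *
     (\<Prod>i<t. qbinom (int (gap n (Suc (Suc i))) - int (gap m (Suc i)))
                     (int (gap n (Suc (Suc i)) - gap n (Suc i))))"
proof -
  have "int (n 1) - int (n (Suc (Suc (Suc i)))) - int (m 1) + int (m (Suc (Suc i))) =
      int (gap n (Suc (Suc i))) - int (gap m (Suc i))" for i
    using row_le_first[OF n, of "Suc (Suc (Suc i))"] row_le_first[OF m, of "Suc (Suc i)"]
    by (simp add: gap_def of_nat_diff)
  moreover have "int (n (Suc (Suc i))) - int (n (Suc (Suc (Suc i)))) =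
     int (gap n (Suc (Suc i)) - gap n (Suc i))" for i
    using row_decreasing[OF n, of "Suc i"] by (simp add: gap_Suc_diff[OF n] of_nat_diff)
  ultimately show ?thesis
    using gap_last[OF n] gap_last[OF m] unfolding s row_kernel_def prod_two_shift by simp
qed

text \<open>If \<open>A_j < B_j\<close> with \<open>j < s\<close>, the binomial of index
  \<open>j + 1\<close> has top \<open>A_(j+1) - B_j\<close> below its lower entry
  \<open>A_(j+1) - A_j\<close>; for \<open>j = s\<close> the leading binomial vanishes.\<close>

lemma row_kernel_eq_0:
  assumes n: "n \<in> rows s N" and m: "m \<in> rows s N'" and "j \<le> s" "gap n j < gap m j"
  shows "row_kernel s n m = (0 :: 'b::comm_ring_1 fps)"
proof (cases "j = s")
  case True
  then show ?thesis
    using assms by (simp add: row_kernel_def gap_last qbinom_def)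
next
  case False
  obtain i where j: "j = Suc i"
    using assms(4) by (cases j) auto
  obtain t where s: "s = Suc t" "i < t"
    using False \<open>j \<le> s\<close> j by (cases s) auto
  have "(\<Prod>i<t. qbinom (int (gap n (Suc (Suc i))) - int (gap m (Suc i)))
                     (int (gap n (Suc (Suc i)) - gap n (Suc i)))) = (0 :: 'b fps)"
  proof (rule prod_zero)
    show "\<exists>i\<in>{..<t}. qbinom (int (gap n (Suc (Suc i))) - int (gap m (Suc i)))
                     (int (gap n (Suc (Suc i)) - gap n (Suc i))) = (0 :: 'b fps)"
      using s assms(4) gap_mono[OF n, of "Suc i"]
      by (intro bexI[of _ i]) (auto simp: qbinom_def j of_nat_diff)
  qed simp
  then show ?thesis
    unfolding row_kernel_gap[OF n m s(1)] by simp
qed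

text \<open>A regrouping of factorials: the denominators \<open>(q)_(A_(j+1) - A_j)\<close> of the
  kernel make up \<open>M(n)\<close>, while those of \<open>M(m)\<close>, namely
  \<open>(q)_(B_(j+1) - B_j)\<close>, complete the new binomials.\<close>

lemma row_kernel_mult_multinom:
  assumes n: "n \<in> rows s N" and m: "m \<in> rows s N'" and "s \<ge> 1"
    and le: "\<And>j. j \<le> s \<Longrightarrow> gap m j \<le> gap n j"
  shows "row_kernel s n m * row_multinom s m = (row_multinom s n *
     (\<Prod>j<s. qbinom (int (gap n (Suc j) - gap m j)) (int (gap m (Suc j) - gap m j))) :: 'b::comm_ring_1 fps)"
proof -
  obtain t where s: "s = Suc t"
    using \<open>s \<ge> 1\<close> by (cases s) auto
  define A B where "A = gap n" and "B = gap m"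
  \<comment> \<open>Each kernel binomial is \<open>P (Suc i) * S i\<close>; the other denominator
    \<open>(q)_(A_j - B_j)\<close> is indexed one lower so that it matches the target
    binomials.\<close>
  define P :: "nat \<Rightarrow> 'b fps" where "P j = qfact (A (Suc j) - B j) * rfact (A (Suc j) - A j)" for j
  define S :: "nat \<Rightarrow> 'b fps" where "S j = rfact (A (Suc j) - B (Suc j))" for j
  have A: "A j \<le> A (Suc j)" and B: "B j \<le> B (Suc j)" for j
    by (simp_all add: A_def B_def gap_mono[OF n] gap_mono[OF m])
  have AB: "B j \<le> A j" if "j \<le> s" for j
    using le that by (simp add: A_def B_def)
  have P0: "P 0 = 1"
    by (simp add: P_def A_def B_def qfact_mult_rfact)
  have "qbinom (int (A (Suc (Suc i))) - int (B (Suc i))) (int (A (Suc (Suc i)) - A (Suc i))) =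
      P (Suc i) * S i" if "i < t" for i
  proof -
    have "B (Suc i) \<le> A (Suc i)"
      using AB s that by simp
    then show ?thesis
      using A[of "Suc i"] qbinom_of_nat[of "A (Suc (Suc i)) - B (Suc i)" "A (Suc (Suc i)) - A (Suc i)", where 'b = 'b]
      by (simp add: P_def S_def of_nat_diff)
  qed
  then have "row_kernel s n m = qbinom (int (A s)) (int (B s)) * (\<Prod>i<t. P (Suc i) * S i)"
    unfolding row_kernel_gap[OF n m s] by (simp add: A_def B_def)
  \<comment> \<open>The shift leaves both products one factor short: \<open>S t\<close> comes from
    the leading binomial, and \<open>P 0 = 1\<close> is free.\<close>
  also have "\<dots> = qfact (A s) * rfact (B s) * ((P 0 * (\<Prod>i<t. P (Suc i))) * ((\<Prod>i<t. S i) * S t))"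
    using AB[of s] unfolding qbinom_of_nat P0 by (simp add: S_def s prod.distrib ac_simps)
  also have "\<dots> = qfact (A s) * rfact (B s) * ((\<Prod>j<s. P j) * (\<Prod>j<s. S j))"
    unfolding s prod.lessThan_Suc_shift[of P] prod.lessThan_Suc[of S] ..
  finally have K: "row_kernel s n m = qfact (A s) * rfact (B s) * ((\<Prod>j<s. P j) * (\<Prod>j<s. S j))" .
  have Q: "qbinom (int (A (Suc j) - B j)) (int (B (Suc j) - B j)) =
      qfact (A (Suc j) - B j) * S j * rfact (B (Suc j) - B j)" if "j < s" for j
    using AB[of "Suc j"] B[of j] that unfolding qbinom_of_nat by (simp add: S_def ac_simps)
  have "row_kernel s n m * row_multinom s m =
      qfact (A s) * (rfact (B s) * qfact (B s)) * (\<Prod>j<s. P j * S j * rfact (B (Suc j) - B j))"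
    unfolding K row_multinom_def gap_last[OF m, symmetric] B_def prod.distrib by (simp only: ac_simps)
  also have "rfact (B s) * qfact (B s) = (1 :: 'b fps)"
    using qfact_mult_rfact by (simp add: mult.commute)
  also have "(\<Prod>j<s. P j * S j * rfact (B (Suc j) - B j)) =
     (\<Prod>j<s. rfact (A (Suc j) - A j)) * (\<Prod>j<s. qbinom (int (A (Suc j) - B j)) (int (B (Suc j) - B j)))"
    unfolding prod.distrib[symmetric] by (intro prod.cong refl) (simp add: Q, simp add: P_def ac_simps)
  finally show ?thesis
    unfolding row_multinom_def gap_last[OF n, symmetric] A_def B_def by (simp add: mult.assoc)
qed

text \<open>Summation by parts: with increments \<open>d j\<close>, both
  \<open>B s * (\<Sum>j<s. d j)\<close> and \<open>(\<Sum>j<s. (B (Suc j) + B j) * d j)\<close>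
  equal \<open>B s ^ 2\<close>.\<close>

lemma sum_complement_increments:
  fixes B :: "nat \<Rightarrow> nat"
  assumes "B 0 = 0" and mono: "\<And>j. B j \<le> B (Suc j)"
  shows "(\<Sum>j<s. (B s - B j) * (B (Suc j) - B j)) = (\<Sum>j<s. B (Suc j) * (B (Suc j) - B j))"
proof -
  have le: "B j \<le> B s" if "j < s" for j
    using lift_Suc_mono_le[of B, OF mono] that by simp
  define d where "d j = int (B (Suc j)) - int (B j)" for j
  have "(\<Sum>j<t. d j) = int (B t)" for t
    by (induction t) (simp_all add: d_def \<open>B 0 = 0\<close>)
  moreover have "(\<Sum>j<t. int (B (Suc j)) * d j) + (\<Sum>j<t. int (B j) * d j) = int (B t) * int (B t)" for t
    by (induction t) (simp_all add: d_def \<open>B 0 = 0\<close> algebra_simps)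
  ultimately have "(\<Sum>j<s. int (B s) * d j) - (\<Sum>j<s. int (B j) * d j) = (\<Sum>j<s. int (B (Suc j)) * d j)"
    unfolding sum_distrib_left[symmetric] by (metis add_diff_cancel_right')
  then have "(\<Sum>j<s. (int (B s) - int (B j)) * d j) = (\<Sum>j<s. int (B (Suc j)) * d j)"
    by (simp only: left_diff_distrib sum_subtractf)
  moreover have "(\<Sum>j<s. (int (B s) - int (B j)) * d j) = int (\<Sum>j<s. (B s - B j) * (B (Suc j) - B j))"
    unfolding of_nat_sum by (rule sum.cong) (simp_all add: d_def le mono of_nat_diff)
  moreover have "(\<Sum>j<s. int (B (Suc j)) * d j) = int (\<Sum>j<s. B (Suc j) * (B (Suc j) - B j))"
    unfolding of_nat_sum by (rule sum.cong) (simp_all add: d_def mono of_nat_diff)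
  ultimately show ?thesis
    by (simp only: of_nat_eq_iff)
qed

text \<open>The powers of \<open>z\<close> agree factor by factor; those of \<open>q\<close> agree
  only in total, by \<open>sum_complement_increments\<close>, since
  \<open>m (Suc j) = B s - B j\<close> for \<open>B = gap m\<close>.\<close>

lemma row_weight_gap:
  assumes m: "m \<in> rows s N"
  shows "row_weight s z m = (\<Prod>j<s. z (Suc j) ^ (gap m (Suc j) - gap m j) *
     fps_X ^ (gap m (Suc j) * (gap m (Suc j) - gap m j)))"
proof -
  have "gap m s - gap m j = m (Suc j)" for j
    using gap_eq[OF m, of j] gap_last[OF m] by simp
  then have "row_weight s z m = (\<Prod>j<s. z (Suc j) ^ (gap m (Suc j) - gap m j)) *
      fps_X ^ (\<Sum>j<s. (gap m s - gap m j) * (gap m (Suc j) - gap m j))"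
    unfolding row_weight_def
    by (simp add: prod.atLeast1_atMost_eq prod.distrib power_sum gap_Suc_diff[OF m])
  then show ?thesis
    using sum_complement_increments[of "gap m" s] gap_mono[OF m]
    by (simp add: prod.distrib power_sum)
qed

lemma finite_rows: "finite (rows s N)"
proof (rule finite_subset)
  show "rows s N \<subseteq> {m. \<forall>j. (j \<in> {..s} \<longrightarrow> m j \<in> {..N}) \<and> (j \<notin> {..s} \<longrightarrow> m j = 0)}"
  proof
    fix m assume m: "m \<in> rows s N"
    have "m j \<le> N" for j
      using row_le_first[OF m, of j] m by (simp add: rows_def)
    then show "m \<in> {m. \<forall>j. (j \<in> {..s} \<longrightarrow> m j \<in> {..N}) \<and> (j \<notin> {..s} \<longrightarrow> m j = 0)}"
      using m by (simp add: rows_def)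
  qed
  show "finite {m. \<forall>j. (j \<in> {..s} \<longrightarrow> m j \<in> {..N}) \<and> (j \<notin> {..s} \<longrightarrow> m j = (0::nat))}"
    by (rule finite_set_of_finite_funs) auto
qed

text \<open>Once \<open>M(m)\<close> is traded for \<open>M(n)\<close>, each nonvanishing term is
  \<open>M(n)\<close> times a product of column factors in the gaps of \<open>m\<close>, and
  \<open>sum_column_chains\<close> evaluates the sum.\<close>

lemma row_total_step:
  fixes z :: "nat \<Rightarrow> 'b::comm_ring_1 fps"
  assumes n: "n \<in> rows s N" and "s \<ge> 1"
  shows "(\<Sum>m\<in>rows s N. row_kernel s n m * row_weight s z m * row_total s z m) = row_total s z n"
proof -
  let ?C = "chains (\<lambda>j. {..gap n j}) 0 s"
  \<comment> \<open>Outside \<open>R\<close> the kernel vanishes, and outside \<open>C\<close> some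
    column factor does; hence the sum over all rows becomes one over all paths.\<close>
  define R where "R = {m \<in> rows s N. \<forall>j\<le>s. gap m j \<le> gap n j}"
  define C where "C = {B \<in> ?C. \<forall>j<s. B j \<le> B (Suc j)}"
  define col where "col B = (\<Prod>j<s. column_factor z (gap n) j (B j) (B (Suc j)))" for B
  have term_eq: "row_kernel s n m * row_weight s z m * row_total s z m = row_multinom s n * col (gap m)"
    if "m \<in> R" for m
  proof -
    have m: "m \<in> rows s N" and le: "\<And>j. j \<le> s \<Longrightarrow> gap m j \<le> gap n j"
      using that by (auto simp: R_def)
    note K = row_kernel_mult_multinom[OF n m \<open>s \<ge> 1\<close>, where 'b = 'b]
    have "row_kernel s n m * row_weight s z m * row_total s z m =
        (row_kernel s n m * row_multinom s m) * row_weight s z m *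
        (\<Prod>j<s. fps_recip (qpoch (z (Suc j)) (gap m (Suc j))))"
      by (simp add: row_total_def ac_simps)
    also have "\<dots> = row_multinom s n * col (gap m)"
      unfolding K[OF le, simplified] row_weight_gap[OF m] col_def column_factor_def
      by (simp add: gap_mono[OF m] prod.distrib ac_simps of_nat_diff)
    finally show ?thesis .
  qed
  have "(\<Sum>m\<in>rows s N. row_kernel s n m * row_weight s z m * row_total s z m) =
      (\<Sum>m\<in>R. row_multinom s n * col (gap m))"
  proof (rule sum.mono_neutral_cong_right)
    show "\<forall>m\<in>rows s N - R. row_kernel s n m * row_weight s z m * row_total s z m = 0"
    proof
      fix m assume "m \<in> rows s N - R"
      then obtain j where "m \<in> rows s N" "j \<le> s" "gap n j < gap m j"
        by (auto simp: R_def not_le)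
      from row_kernel_eq_0[OF n this, where 'b = 'b]
      show "row_kernel s n m * row_weight s z m * row_total s z m = 0"
        by simp
    qed
    show "R \<subseteq> rows s N"
      by (auto simp: R_def)
  qed (simp_all add: finite_rows term_eq)
  also have "\<dots> = row_multinom s n * (\<Sum>m\<in>R. col (gap m))"
    by (simp add: sum_distrib_left)
  \<comment> \<open>A row is recovered from its gaps by \<open>m j = B s - B (j - 1)\<close>,
    because \<open>B s = m 1\<close>.\<close>
  also have "(\<Sum>m\<in>R. col (gap m)) = (\<Sum>B\<in>C. col B)"
  proof (rule sum.reindex_bij_witness[where
        j = "\<lambda>m j. if j \<le> s then gap m j else 0" and
        i = "\<lambda>B j. if 1 \<le> j \<and> j \<le> s then B s - B (j - 1) else 0"])
    fix m assume "m \<in> R"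
    then have m: "m \<in> rows s N" and le: "\<And>j. j \<le> s \<Longrightarrow> gap m j \<le> gap n j"
      by (auto simp: R_def)
    show "(\<lambda>j. if 1 \<le> j \<and> j \<le> s then (if s \<le> s then gap m s else 0) - (if j - 1 \<le> s then gap m (j - 1) else 0) else 0) = m"
    proof
      fix j
      show "(if 1 \<le> j \<and> j \<le> s then (if s \<le> s then gap m s else 0) - (if j - 1 \<le> s then gap m (j - 1) else 0) else 0) = m j"
        using gap_eq[OF m, of "j - 1"] gap_last[OF m] m by (cases j) (auto simp: rows_def)
    qed
    show "(\<lambda>j. if j \<le> s then gap m j else 0) \<in> C"
      using le gap_mono[OF m] by (auto simp: C_def chains_def)
    show "col (\<lambda>j. if j \<le> s then gap m j else 0) = col (gap m)"
      by (simp add: col_def)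
  next
    fix B assume "B \<in> C"
    then have B: "\<And>j. j \<le> s \<Longrightarrow> B j \<le> gap n j" "\<And>j. j > s \<Longrightarrow> B j = 0" "\<And>j. j < s \<Longrightarrow> B j \<le> B (Suc j)"
      by (auto simp: C_def chains_def)
    have B0: "B 0 = 0"
      using B(1)[of 0] by simp
    have mono: "B j \<le> B s" if "j \<le> s" for j
      using that by (induction rule: inc_induct) (auto intro: order_trans B(3))
    let ?m = "\<lambda>j. if 1 \<le> j \<and> j \<le> s then B s - B (j - 1) else 0"
    have gap: "gap ?m j = B j" if "j \<le> s" for j
      using that mono[of j] B0 \<open>s \<ge> 1\<close> by (cases "j = s") (auto simp: gap_def)
    then show "(\<lambda>j. if j \<le> s then gap ?m j else 0) = B"
      using B(2) by auto
    have "?m 1 \<le> N"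
      using B(1)[of s] B0 gap_last[OF n] n by (auto simp: rows_def)
    moreover have "?m (Suc j) \<le> ?m j" if "j \<ge> 1" for j
      using that B(3)[of "j - 1"] by (auto intro: diff_le_mono2)
    ultimately show "?m \<in> R"
      using B(1) gap by (auto simp: R_def rows_def)
  qed
  also have "(\<Sum>B\<in>C. col B) = (\<Sum>B\<in>?C. col B)"
  proof (rule sum.mono_neutral_left)
    show "finite ?C"
      by (rule finite_chains) simp
    show "\<forall>B\<in>?C - C. col B = 0"
    proof
      fix B assume "B \<in> ?C - C"
      then obtain j where "j < s" "\<not> B j \<le> B (Suc j)"
        by (auto simp: C_def)
      then show "col B = 0"
        unfolding col_def by (intro prod_zero) (auto simp: column_factor_def)
    qed
  qed (auto simp: C_def)
  also have "\<dots> = (\<Prod>j<s. fps_recip (qpoch (z (Suc j)) (gap n (Suc j))))"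
    unfolding col_def by (rule sum_column_chains) (auto simp: gap_mono[OF n])
  finally show ?thesis
    by (simp add: row_total_def)
qed


subsection \<open>Approximation modulo powers of \<open>q\<close>\<close>

lemma dvd_mult_diff:
  fixes a b c d e :: "'b::comm_ring_1"
  assumes "e dvd a - b" "e dvd c - d"
  shows "e dvd a * c - b * d"
proof -
  have "a * c - b * d = (a - b) * c + b * (c - d)"
    by (simp add: algebra_simps)
  then show ?thesis
    using assms by (simp add: dvd_add)
qed

lemma dvd_prod_diff:
  fixes f g :: "'i \<Rightarrow> 'b::comm_ring_1"
  shows "(\<And>i. i \<in> I \<Longrightarrow> e dvd f i - g i) \<Longrightarrow> e dvd prod f I - prod g I"
  by (induction I rule: infinite_finite_induct) (auto intro!: dvd_mult_diff)

text \<open>Each factor after the first \<open>N\<close> is 1 modulo \<open>q^(N+1)\<close>.\<close>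

lemma qpoch_dvd_diff:
  fixes x :: "'b::comm_ring_1 fps"
  assumes "N \<le> m"
  shows "fps_X ^ Suc N dvd qpoch x m - qpoch x N"
  using assms
proof (induction m rule: dec_induct)
  case (step m)
  have "fps_X ^ Suc N dvd (fps_X ^ Suc m :: 'b fps)"
    using step(1) by (intro le_imp_power_dvd) simp
  note dvd_diff[OF step.IH dvd_mult[OF this, of "qpoch x m * x"]]
  also have "qpoch x m - qpoch x N - qpoch x m * x * fps_X ^ Suc m = qpoch x (Suc m) - qpoch x N"
    by (simp add: qpoch_Suc algebra_simps)
  finally show ?case .
qed simp

lemma qpoch_inf_dvd_diff:
  fixes x :: "'b::comm_ring_1 fps"
  shows "fps_X ^ Suc N dvd qpoch_inf (x * fps_X) - qpoch x N"
proof -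
  define f where "f i = 1 - x * fps_X * fps_X ^ i" for i
  \<comment> \<open>Coefficient \<open>k\<close> of \<open>qpoch x m\<close> is stable from
    \<open>m = k\<close> on, so the limit is read off the diagonal.\<close>
  define P where "P = Abs_fps (\<lambda>k. fps_nth (qpoch x k) k)"
  have stable: "fps_nth (qpoch x m) k = fps_nth (qpoch x k) k" if "k \<le> m" for k m
    using qpoch_dvd_diff[OF that, of x] by (simp add: fps_X_power_dvd_iff del: power_Suc)
  have partial: "(\<Prod>i\<le>n. f (i + 0)) = qpoch x (Suc n)" for n
    by (induction n) (simp_all add: f_def qpoch_Suc mult.assoc)
  have lim: "(\<lambda>n. \<Prod>i\<le>n. f (i + 0)) \<longlonglongrightarrow> P"
  proof (rule tendsto_fpsI)
    fix k
    show "\<forall>\<^sub>F n in sequentially. fps_nth (\<Prod>i\<le>n. f (i + 0)) k = fps_nth P k"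
      unfolding partial
    proof (rule eventually_sequentiallyI)
      fix n assume "k \<le> n"
      then show "fps_nth (qpoch x (Suc n)) k = fps_nth P k"
        using stable[of k "Suc n"] by (simp add: P_def)
    qed
  qed
  have "fps_nth P 0 \<noteq> 0"
    by (simp add: P_def)
  then have "P \<noteq> 0"
    by (metis fps_zero_nth)
  with lim have raw: "raw_has_prod f 0 P"
    unfolding raw_has_prod_def by blast
  have "fps_nth (f i) 0 \<noteq> 0" for i
    by (simp add: f_def fps_nth_0_mult)
  then have nz: "f i \<noteq> 0" for i
    by (metis fps_zero_nth)
  \<comment> \<open>\<open>has_prod\<close> also admits the value 0 when some factor is 0; the
    constant coefficients exclude this, so the limit is the only possible value.\<close>
  have "prodinf f = P"
    unfolding prodinf_def
  proof (rule the_equality)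
    show "f has_prod P"
      using raw by (simp add: has_prod_def)
    show "p = P" if "f has_prod p" for p
    proof -
      have "raw_has_prod f 0 p"
        using that nz unfolding has_prod_def by blast
      then have "(\<lambda>n. \<Prod>i\<le>n. f (i + 0)) \<longlonglongrightarrow> p"
        unfolding raw_has_prod_def by blast
      then show ?thesis
        using lim by (rule LIMSEQ_unique)
    qed
  qed
  then have "qpoch_inf (x * fps_X) = P"
    by (simp add: qpoch_inf_def f_def[abs_def])
  moreover have "fps_nth P k = fps_nth (qpoch x N) k" if "k \<le> N" for k
    using stable[OF that] by (simp add: P_def)
  ultimately show ?thesis
    by (simp add: fps_X_power_dvd_iff del: power_Suc)
qed

lemma qpoch_inf_nth_0 [simp]: "fps_nth (qpoch_inf (x * fps_X)) 0 = (1 :: 'b::comm_ring_1)"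
  using qpoch_inf_dvd_diff[of 0 x] unfolding fps_X_power_dvd_iff by simp

text \<open>In gap form the exponent in column \<open>t\<close> is \<open>gap m (Suc t) * d\<close>,
  which is at least the increment \<open>d\<close> because \<open>d > 0\<close> forces a positive
  gap; the increments add up to \<open>m 1\<close>.\<close>

lemma row_weight_dvd:
  fixes z :: "nat \<Rightarrow> 'b::comm_ring_1 fps"
  assumes m: "m \<in> rows s N"
  shows "fps_X ^ m 1 dvd row_weight s z m"
proof -
  have "fps_X ^ gap m t dvd (\<Prod>j<t. z (Suc j) ^ (gap m (Suc j) - gap m j) *
     fps_X ^ (gap m (Suc j) * (gap m (Suc j) - gap m j)))" for t
  proof (induction t)
    case (Suc t)
    define d where "d = gap m (Suc t) - gap m t"
    have "d \<le> gap m (Suc t) * d"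
      by (cases "d = 0") (auto simp: d_def)
    then have "fps_X ^ d dvd (z (Suc t) ^ d * fps_X ^ (gap m (Suc t) * d))"
      by (intro dvd_mult le_imp_power_dvd)
    then have "fps_X ^ gap m t * fps_X ^ d dvd (\<Prod>j<Suc t. z (Suc j) ^ (gap m (Suc j) - gap m j) *
     fps_X ^ (gap m (Suc j) * (gap m (Suc j) - gap m j)))"
      unfolding prod.lessThan_Suc d_def by (intro mult_dvd_mono Suc.IH)
    then show ?case
      using gap_mono[OF m, of t] by (simp add: d_def flip: power_add)
  qed simp
  from this[of s] show ?thesis
    by (simp add: row_weight_gap[OF m] gap_last[OF m])
qed

lemma row_total_zero: "row_total s z (\<lambda>_. 0) = 1"
  by (simp add: row_total_def row_multinom_def gap_def)

lemma row_weight_zero: "row_weight s z (\<lambda>_. 0) = 1"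
  by (simp add: row_weight_def)

lemma row_kernel_zero: "row_kernel s (\<lambda>_. 0) (\<lambda>_. 0) = 1"
  by (simp add: row_kernel_def qbinom_0_0)

lemma row_kernel_nonzero_imp: "row_kernel s n m \<noteq> 0 \<Longrightarrow> m 1 \<le> n 1"
  by (auto simp: row_kernel_def qbinom_def split: if_splits)

text \<open>
  The top row acts as a level \<open>0\<close> above the family: its kernel \<open>[N, n\<^sub>1]\<close> tends to the factor
  \<open>1/(q)\<^sub>n\<close> with \<open>n = n\<^sub>1\<close> of the summand as \<open>N\<close> grows.
\<close>

definition top_row :: "nat \<Rightarrow> nat \<Rightarrow> nat" where
  "top_row N j = (if j = 1 then N else 0)"

lemma top_row_in_rows: "s \<ge> 1 \<Longrightarrow> top_row N \<in> rows s N"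
  by (auto simp: top_row_def rows_def)

lemma gap_top_row: "gap (top_row N) j = (if j = 0 then 0 else N)"
  by (simp add: gap_def top_row_def)

text \<open>All gaps except the zeroth are \<open>N\<close>, so the multinomial coefficient is
  \<open>(q)_N / (q)_N\<close>.\<close>

lemma row_total_top_row:
  fixes z :: "nat \<Rightarrow> 'b::comm_ring_1 fps"
  assumes "s \<ge> 1"
  shows "row_total s z (top_row N) = (\<Prod>j=1..s. fps_recip (qpoch (z j) N))"
proof -
  obtain t where "s = Suc t"
    using assms by (cases s) auto
  then have "row_multinom s (top_row N) = (1 :: 'b fps)"
    unfolding row_multinom_def gap_top_row
    by (simp add: prod.lessThan_Suc_shift top_row_def qfact_mult_rfact del: prod.lessThan_Suc)
  then show ?thesis
    by (simp add: row_total_def gap_top_row prod.atLeast1_atMost_eq)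
qed

lemma row_kernel_top_row:
  assumes m: "m \<in> rows s N" and "s \<ge> 1"
  shows "row_kernel s (top_row N) m = (qbinom (int N) (int (m 1)) :: 'b::comm_ring_1 fps)"
proof -
  obtain t where s: "s = Suc t"
    using \<open>s \<ge> 1\<close> by (cases s) auto
  have "qbinom (int N - int (gap m j)) 0 = (1 :: 'b fps)" for j
    using qbinom_0_right[of "N - gap m j", where 'b = 'b] gap_le_first[of m j] m
    by (simp add: rows_def of_nat_diff)
  then show ?thesis
    unfolding row_kernel_gap[OF top_row_in_rows[OF \<open>s \<ge> 1\<close>] m s] gap_last[OF m] gap_top_row
    by (simp add: s)
qed

lemma qfact_conv_qpoch: "qfact n = qpoch 1 n"
  by (simp add: qfact_def qpoch_def)

text \<open>\<open>[N, m]\<close> is \<open>1/(q)_m\<close> times \<open>(q)_N / (q)_(N-m)\<close>,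
  and the latter quotient is 1 modulo \<open>q^(N-m+1)\<close>.\<close>

lemma qbinom_dvd_diff:
  assumes "m \<le> N"
  shows "fps_X ^ Suc (N - m) dvd rfact m - (qbinom (int N) (int m) :: 'b::comm_ring_1 fps)"
proof -
  have "fps_X ^ Suc (N - m) dvd qfact N - (qfact (N - m) :: 'b fps)"
    unfolding qfact_conv_qpoch by (rule qpoch_dvd_diff) simp
  then have "fps_X ^ Suc (N - m) dvd - (rfact m * rfact (N - m) * (qfact N - (qfact (N - m) :: 'b fps)))"
    by (simp del: power_Suc)
  also have "- (rfact m * rfact (N - m) * (qfact N - qfact (N - m))) =
      rfact m * (qfact (N - m) * rfact (N - m)) - qbinom (int N) (int m)"
    using assms unfolding qbinom_of_nat by (simp add: algebra_simps)
  finally show ?thesis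
    by (simp add: qfact_mult_rfact del: power_Suc)
qed

text \<open>Nonzero kernels make the first entries weakly decreasing, so a positive one in the last
  row makes all \<open>M + 1\<close> positive, and each row weight supplies a factor
  \<open>q\<close>.\<close>

lemma level_product_dvd:
  fixes z :: "nat \<Rightarrow> 'b::comm_ring_1 fps"
  assumes g: "\<And>i. i \<le> M \<Longrightarrow> g (Suc i) \<in> rows s N" and "g (Suc M) 1 \<ge> 1"
  shows "fps_X ^ Suc M dvd (\<Prod>i<M. row_kernel s (g (Suc i)) (g (Suc (Suc i)))) *
    (\<Prod>i<Suc M. row_weight s z (g (Suc i)))"
proof (cases "\<exists>i<M. row_kernel s (g (Suc i)) (g (Suc (Suc i))) = (0 :: 'b fps)")
  case True
  then have "(\<Prod>i<M. row_kernel s (g (Suc i)) (g (Suc (Suc i)))) = (0 :: 'b fps)"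
    by (intro prod_zero) auto
  then show ?thesis by simp
next
  case False
  have pos: "g (Suc i) 1 \<ge> 1" if "i \<le> M" for i
    using that
  proof (induction rule: inc_induct)
    case (step i)
    then show ?case
      using False row_kernel_nonzero_imp[of s "g (Suc i)" "g (Suc (Suc i))", where 'a = 'b] by force
  qed (rule assms)
  have "(\<Prod>i<Suc M. fps_X) dvd (\<Prod>i<Suc M. row_weight s z (g (Suc i)))"
  proof (rule prod_dvd_prod)
    fix i assume "i \<in> {..<Suc M}"
    then have i: "i \<le> M" by simp
    have "fps_X ^ 1 dvd (fps_X ^ g (Suc i) 1 :: 'b fps)"
      using pos[OF i] by (rule le_imp_power_dvd)
    also have "\<dots> dvd row_weight s z (g (Suc i))"
      by (rule row_weight_dvd[OF g[OF i]])
    finally show "fps_X dvd row_weight s z (g (Suc i))" by simp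
  qed
  then show ?thesis
    by (simp add: prod_constant del: prod.lessThan_Suc power_Suc)
qed

subsection \<open>Families as chains of rows\<close>

lemma level_factor_eq:
  "level_factor r n i =
     row_weight (r - 1) zvar (n i) * row_kernel (r - 1) (n i) (n (Suc i))"
  by (simp add: level_factor_def row_weight_def row_kernel_def mult.assoc)

lemma summand_eq:
  assumes n: "n \<in> families r" and R: "\<And>i. i > R \<Longrightarrow> n i = (\<lambda>_. 0)"
  shows "summand r n = rfact (n 1 1) * (\<Prod>i<R. row_weight (r - 1) zvar (n (Suc i))) *
    ((\<Prod>i<R. row_kernel (r - 1) (n (Suc i)) (n (Suc (Suc i)))) :: 'a::comm_ring_1 zpoly fps)"
proof -
  have "level_factor r n i = (1 :: 'a zpoly fps)" if "i > R" for i
    using R[of i] R[of "Suc i"] that by (simp add: level_factor_eq row_weight_zero row_kernel_zero)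
  then have sub: "{i. 1 \<le> i \<and> level_factor r n i \<noteq> (1 :: 'a zpoly fps)} \<subseteq> {1..R}"
    by (auto simp: not_less[symmetric])
  have "(\<Prod>i\<in>{i. 1 \<le> i \<and> level_factor r n i \<noteq> (1 :: 'a zpoly fps)}. level_factor r n i) =
      (\<Prod>i=1..R. level_factor r n i :: 'a zpoly fps)"
    by (rule prod.mono_neutral_left) (use sub in auto)
  then show ?thesis
    by (simp add: summand_def rfact_def level_factor_eq prod.atLeast1_atMost_eq prod.distrib mult.assoc)
qed

definition level_rows :: "nat \<Rightarrow> nat \<Rightarrow> nat \<Rightarrow> (nat \<Rightarrow> nat) set" where
  "level_rows s N i = (if i = 0 then {top_row N} else rows s N)"

text \<open>Cutting after level \<open>N + 1\<close> is harmless modulo \<open>q^(N+1)\<close>,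
  because \<open>N + 1\<close> nonzero levels already supply that power.\<close>

abbreviation level_chains :: "nat \<Rightarrow> nat \<Rightarrow> (nat \<Rightarrow> nat \<Rightarrow> nat) set" where
  "level_chains s N \<equiv> chains (level_rows s N) (\<lambda>_. 0) (Suc N)"

lemma finite_level_chains: "finite (level_chains s N)"
  by (rule finite_chains) (simp add: level_rows_def finite_rows)

text \<open>Differs from the summand at both ends: \<open>[N, n_1]\<close> replaces
  \<open>1/(q)_(n_1)\<close> at the top, and \<open>H\<close> of the last row replaces its kernel to
  the zero row. This makes the finite sum exactly \<open>H(top_row N)\<close>.\<close>

definition chain_term :: "nat \<Rightarrow> (nat \<Rightarrow> 'b::comm_ring_1 fps) \<Rightarrow> nat \<Rightarrow> (nat \<Rightarrow> nat \<Rightarrow> nat) \<Rightarrow> 'b fps" where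
  "chain_term s z N f = (\<Prod>i<Suc N. row_kernel s (f i) (f (Suc i)) * row_weight s z (f (Suc i))) *
     row_total s z (f (Suc N))"

lemma sum_chain_term:
  assumes "s \<ge> 1"
  shows "(\<Sum>f\<in>level_chains s N. chain_term s z N f) = (\<Prod>j=1..s. fps_recip (qpoch (z j) N))"
proof -
  have "(\<Sum>f\<in>level_chains s N. chain_term s z N f) = (\<Sum>y\<in>level_rows s N 0. row_total s z y)"
    unfolding chain_term_def
  proof (rule sum_chains_telescope[where h = "\<lambda>_. row_total s z" and g = "\<lambda>_ n m. row_kernel s n m * row_weight s z m"])
    fix i y assume "y \<in> level_rows s N i"
    then have "y \<in> rows s N"
      using top_row_in_rows[OF assms] by (auto simp: level_rows_def split: if_splits)
    then show "(\<Sum>x\<in>level_rows s N (Suc i). row_kernel s y x * row_weight s z x * row_total s z x) = row_total s z y"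
      using row_total_step assms by (simp add: level_rows_def)
  qed
  then show ?thesis
    by (simp add: level_rows_def row_total_top_row[OF assms])
qed

text \<open>Level 0 of a chain holds the auxiliary top row, whereas a family vanishes there; hence
  the reset.\<close>

lemma level_chain_family:
  assumes f: "f \<in> level_chains (r - 1) N"
  shows "f(0 := \<lambda>_. 0) \<in> families r"
proof -
  have *: "1 \<le> i \<and> i \<le> Suc N \<and> 1 \<le> j \<and> j \<le> r - 1" if "(f(0 := \<lambda>_. 0)) i j \<noteq> 0" for i j
  proof -
    have "i \<noteq> 0" "f i j \<noteq> 0"
      using that by (auto split: if_splits)
    moreover from this have i: "i \<le> Suc N"
      using f by (auto simp: chains_def not_less[symmetric] simp del: not_less)
    ultimately have "f i \<in> rows (r - 1) N"
      using f by (auto simp: chains_def level_rows_def)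
    then have "1 \<le> j" "j \<le> r - 1"
      using \<open>f i j \<noteq> 0\<close> by (auto simp: rows_def not_less[symmetric] Suc_le_eq intro!: gr0I)
    with i \<open>i \<noteq> 0\<close> show ?thesis by simp
  qed
  have "{(i, j). (f(0 := \<lambda>_. 0)) i j \<noteq> 0} \<subseteq> {..Suc N} \<times> {..r - 1}"
    using * by fastforce
  then have "finite {(i, j). (f(0 := \<lambda>_. 0)) i j \<noteq> 0}"
    by (rule finite_subset) simp
  then show ?thesis
    using * unfolding families_def by blast
qed

text \<open>If the last row is nonzero, \<open>level_product_dvd\<close> makes both terms divisible.
  Otherwise both closing factors are 1, and \<open>q^(N - n_1 + 1)\<close> from the binomial joins
  \<open>q^(n_1)\<close> from the first row weight.\<close>

lemma chain_term_dvd_diff: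
  assumes f: "f \<in> level_chains (r - 1) N" and "r \<ge> 2"
  shows "fps_X ^ Suc N dvd summand r (f(0 := \<lambda>_. 0)) - (chain_term (r - 1) zvar N f :: 'a::comm_ring_1 zpoly fps)"
proof -
  define s where "s = r - 1"
  \<comment> \<open>The part common to the summand and the chain term.\<close>
  define C :: "'a zpoly fps" where "C = (\<Prod>i<N. row_kernel s (f (Suc i)) (f (Suc (Suc i)))) *
      (\<Prod>i<Suc N. row_weight s zvar (f (Suc i)))"
  have rows: "f (Suc i) \<in> rows s N" if "i \<le> N" for i
    using f that by (auto simp: chains_def level_rows_def s_def)
  have f0: "f 0 = top_row N"
    using f by (auto simp: chains_def level_rows_def)
  have beyond: "f i = (\<lambda>_. 0)" if "i > Suc N" for i
    using f that by (auto simp: chains_def)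
  have "summand r (f(0 := \<lambda>_. 0)) = rfact (f 1 1) * (\<Prod>i<Suc N. row_weight s zvar (f (Suc i))) *
    ((\<Prod>i<Suc N. row_kernel s (f (Suc i)) (f (Suc (Suc i)))) :: 'a zpoly fps)"
    using summand_eq[OF level_chain_family[OF f], where R = "Suc N" and 'a = 'a] beyond
    by (simp add: s_def)
  then have summand: "summand r (f(0 := \<lambda>_. 0)) = rfact (f 1 1) * C *
      (row_kernel s (f (Suc N)) (f (Suc (Suc N))) :: 'a zpoly fps)"
    by (simp add: C_def ac_simps)
  have "(\<Prod>i<Suc N. row_kernel s (f i) (f (Suc i)) :: 'a zpoly fps) =
      row_kernel s (f 0) (f 1) * (\<Prod>i<N. row_kernel s (f (Suc i)) (f (Suc (Suc i))))"
    unfolding prod.lessThan_Suc_shift by simp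
  then have chain: "chain_term s zvar N f = qbinom (int N) (int (f 1 1)) * C * (row_total s zvar (f (Suc N)) :: 'a zpoly fps)"
    using row_kernel_top_row[OF rows[of 0], where 'b = "'a zpoly"] \<open>r \<ge> 2\<close>
    unfolding chain_term_def prod.distrib f0 by (simp add: C_def s_def mult.assoc)
  show ?thesis
  proof (cases "f (Suc N) 1 \<ge> 1")
    case True
    then have "fps_X ^ Suc N dvd C"
      unfolding C_def by (intro level_product_dvd) (auto intro: rows)
    then show ?thesis
      unfolding summand chain[unfolded s_def] by (intro dvd_diff dvd_mult2[OF dvd_mult])
  next
    case False
    then have "f (Suc N) j = 0" for j
      using row_le_first[OF rows[of N], of j] by simp
    then have last: "f (Suc N) = (\<lambda>_. 0)"
      by auto
    have le: "f 1 1 \<le> N"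
      using rows[of 0] by (simp add: rows_def)
    have "fps_X ^ f 1 1 dvd row_weight s zvar (f (Suc 0))"
      using row_weight_dvd[OF rows[of 0]] by simp
    also have "\<dots> dvd C"
      unfolding C_def by (intro dvd_mult dvd_prodI[where f = "\<lambda>i. row_weight s zvar (f (Suc i))"]) auto
    finally have "fps_X ^ Suc (N - f 1 1) * fps_X ^ f 1 1 dvd (rfact (f 1 1) - qbinom (int N) (int (f 1 1))) * C"
      using qbinom_dvd_diff[OF le] by (intro mult_dvd_mono)
    also have "fps_X ^ Suc (N - f 1 1) * fps_X ^ f 1 1 = (fps_X ^ Suc N :: 'a zpoly fps)"
      using le by (simp flip: power_add power_Suc)
    also have "(rfact (f 1 1) - qbinom (int N) (int (f 1 1))) * C = summand r (f(0 := \<lambda>_. 0)) - chain_term s zvar N f"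
      unfolding summand chain last beyond[OF lessI] row_kernel_zero row_total_zero
      by (simp add: algebra_simps)
    finally show ?thesis
      by (simp add: s_def)
  qed
qed

text \<open>A first entry above \<open>N\<close> would give \<open>q^(N+1)\<close> through the first
  row weight, and a nonzero row beyond level \<open>N + 1\<close> would give it through
  \<open>level_product_dvd\<close>.\<close>

lemma summand_dvd_or_level_chain:
  assumes n: "n \<in> families r" and "r \<ge> 2" and "\<not> fps_X ^ Suc N dvd (summand r n :: 'a::comm_ring_1 zpoly fps)"
  shows "n \<in> (\<lambda>f. f(0 := \<lambda>_. 0)) ` level_chains (r - 1) N"
proof -
  define s where "s = r - 1"
  let ?W = "\<lambda>i. row_weight s zvar (n (Suc i)) :: 'a zpoly fps"
  let ?K = "\<lambda>i. row_kernel s (n (Suc i)) (n (Suc (Suc i))) :: 'a zpoly fps"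
  obtain R where R: "\<And>i j. R \<le> i \<Longrightarrow> n i j = 0"
    using families_bound[OF n] by blast
  \<comment> \<open>The bound \<open>T\<close> is left free so that the products can be extended to
    include any required factor.\<close>
  have summand: "summand r n = rfact (n 1 1) * (\<Prod>i<T. ?W i) * (\<Prod>i<T. ?K i)" if "T \<ge> R" for T
    unfolding s_def by (rule summand_eq[OF n]) (use R that in auto)
  have ndvd: "\<not> F dvd summand r n" if "fps_X ^ Suc N dvd F" for F :: "'a zpoly fps"
    using assms(3) that dvd_trans by blast
  have nz: "summand r n \<noteq> (0 :: 'a zpoly fps)"
    using assms(3) by auto
  have outside: "n i j = 0" if "i = 0 \<or> j = 0 \<or> j > s" for i j
    using n that by (force simp: families_def s_def)
  have "n i (Suc j) \<le> n i j" if "i \<ge> 1" "j \<ge> 1" for i j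
  proof (cases "j \<le> s")
    case True
    then show ?thesis
      using summand_eq_0_if_negative[OF n that, where 'a = 'a] nz by (force simp: s_def not_less[symmetric])
  qed (use outside in simp)
  then have row: "n (Suc i) \<in> rows s (n (Suc i) 1)" for i
    using outside by (auto simp: rows_def)
  have "?K i \<noteq> 0" for i
  proof
    assume "?K i = 0"
    then have "(\<Prod>i<max R (Suc i). ?K i) = 0"
      by (intro prod_zero) (auto intro!: bexI[of _ i])
    then show False
      using nz summand[of "max R (Suc i)"] by simp
  qed
  then have decr: "n (Suc (Suc i)) 1 \<le> n (Suc i) 1" for i
    using row_kernel_nonzero_imp by blast
  then have le_first: "n (Suc i) 1 \<le> n 1 1" for i
    by (induction i) (auto intro: order_trans)
  have "n 1 1 \<le> N"
  proof (rule ccontr)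
    assume "\<not> n 1 1 \<le> N"
    then have "fps_X ^ Suc N dvd (fps_X ^ n 1 1 :: 'a zpoly fps)"
      by (intro le_imp_power_dvd) simp
    also have "\<dots> dvd ?W 0"
      using row_weight_dvd[OF row[of 0]] by simp
    finally have "\<not> ?W 0 dvd summand r n"
      by (rule ndvd)
    moreover have "?W 0 dvd (\<Prod>i<max R 1. ?W i)"
      by (intro dvd_prodI[where f = ?W]) auto
    ultimately show False
      using summand[of "max R 1"] by (simp add: dvd_mult dvd_mult2)
  qed
  then have rowN: "n (Suc i) \<in> rows s N" for i
    using row[of i] le_first[of i] by (simp add: rows_def)
  have "n (Suc (Suc N)) 1 = 0"
  proof (rule ccontr)
    assume "n (Suc (Suc N)) 1 \<noteq> 0"
    then have "n (Suc N) 1 \<ge> 1"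
      using decr[of N] by simp
    with rowN have "fps_X ^ Suc N dvd (\<Prod>i<N. ?K i) * (\<Prod>i<Suc N. ?W i)"
      by (intro level_product_dvd)
    then have "\<not> (\<Prod>i<N. ?K i) * (\<Prod>i<Suc N. ?W i) dvd summand r n"
      by (rule ndvd)
    moreover have "(\<Prod>i<N. ?K i) * (\<Prod>i<Suc N. ?W i) dvd
        (\<Prod>i<max R (Suc N). ?K i) * (\<Prod>i<max R (Suc N). ?W i)"
      by (intro mult_dvd_mono prod_dvd_prod_subset) auto
    ultimately show False
      unfolding summand[OF max.cobounded1, of "Suc N"] by (simp add: dvd_mult ac_simps del: prod.lessThan_Suc)
  qed
  then have "n (Suc (Suc N) + i) 1 = 0" for i
  proof (induction i)
    case (Suc i)
    then show ?case
      using decr[of "Suc N + i"] by simp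
  qed simp
  then have "n i 1 = 0" if "i > Suc N" for i
    using that by (metis Suc_leI le_add_diff_inverse)
  then have "n i j = 0" if "i > Suc N" for i j
    using row_le_first[OF row[of "i - 1"], of j] that by simp
  then have "n i = (\<lambda>_. 0)" if "i > Suc N" for i
    using that by auto
  moreover have "n i \<in> rows s N" if "i \<noteq> 0" for i
    using rowN[of "i - 1"] that by simp
  ultimately have "n(0 := top_row N) \<in> level_chains (r - 1) N"
    by (auto simp: chains_def level_rows_def s_def)
  moreover have "n = (n(0 := top_row N))(0 := \<lambda>_. 0)"
    using outside by (auto simp: fun_eq_iff)
  ultimately show ?thesis
    by (intro image_eqI)
qed

section \<open>The sum over all families, coefficient by coefficient\<close>

theorem theorem8p3:
  fixes r :: nat
  assumes "r \<ge> 2"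
  shows "((\<lambda>n. summand r n :: 'a::comm_ring_1 zpoly fps) has_sum
           (\<Prod>j=1..r-1. fps_recip (qpoch_inf (zvar j * fps_X)))) (families r)"
proof (rule has_sum_fpsI)
  fix k
  let ?S = "\<Prod>j=1..r-1. fps_recip (qpoch_inf (zvar j * fps_X)) :: 'a zpoly fps"
  \<comment> \<open>The precision is tied to the coefficient: chains with \<open>N = k\<close>
    decide everything modulo \<open>q^(k+1)\<close>, hence coefficient \<open>k\<close>.\<close>
  let ?G = "(\<lambda>f. f(0 := \<lambda>_. 0)) ` level_chains (r - 1) k"
  have fin: "finite ?G"
    by (simp add: finite_level_chains)
  have sub: "{n \<in> families r. fps_nth (summand r n :: 'a zpoly fps) k \<noteq> 0} \<subseteq> ?G"
  proof
    fix n assume n: "n \<in> {n \<in> families r. fps_nth (summand r n :: 'a zpoly fps) k \<noteq> 0}"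
    then have "\<not> fps_X ^ Suc k dvd (summand r n :: 'a zpoly fps)"
      unfolding fps_X_power_dvd_iff by blast
    with n show "n \<in> ?G"
      using summand_dvd_or_level_chain[OF _ assms] by blast
  qed
  show "finite {n \<in> families r. fps_nth (summand r n :: 'a zpoly fps) k \<noteq> 0}"
    using sub fin by (rule finite_subset)
  \<comment> \<open>Resetting level 0 loses no information, since it always holds
    \<open>top_row k\<close>.\<close>
  have inj: "inj_on (\<lambda>f. f(0 := \<lambda>_. 0)) (level_chains (r - 1) k)"
  proof (rule inj_onI)
    fix f g assume f: "f \<in> level_chains (r - 1) k" and g: "g \<in> level_chains (r - 1) k"
      and eq: "f(0 := \<lambda>_. 0) = g(0 := \<lambda>_. 0)"
    have "h 0 = top_row k" if "h \<in> level_chains (r - 1) k" for h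
      using that by (auto simp: chains_def level_rows_def)
    then have "f 0 = g 0"
      using f g by simp
    then show "f = g"
      using eq by (metis fun_upd_triv fun_upd_upd)
  qed
  let ?C = "\<Sum>f\<in>level_chains (r - 1) k. chain_term (r - 1) zvar k f :: 'a zpoly fps"
  have "fps_X ^ Suc k dvd (\<Sum>f\<in>level_chains (r - 1) k. summand r (f(0 := \<lambda>_. 0)) - chain_term (r - 1) zvar k f :: 'a zpoly fps)"
    by (intro dvd_sum chain_term_dvd_diff assms)
  then have 1: "fps_nth (\<Sum>n\<in>?G. summand r n) k = fps_nth ?C k"
    unfolding fps_X_power_dvd_iff sum.reindex[OF inj] o_def by (simp add: sum_subtractf)
  have "fps_X ^ Suc k dvd ?S - (\<Prod>j=1..r-1. fps_recip (qpoch (zvar j) k))"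
  proof (rule dvd_prod_diff)
    fix j
    have "fps_X ^ Suc k dvd - (qpoch_inf (zvar j * fps_X) - qpoch (zvar j) k :: 'a zpoly fps)"
      using qpoch_inf_dvd_diff by (subst dvd_minus_iff)
    then show "fps_X ^ Suc k dvd fps_recip (qpoch_inf (zvar j * fps_X)) - (fps_recip (qpoch (zvar j) k) :: 'a zpoly fps)"
      by (subst fps_recip_diff) (auto simp del: power_Suc)
  qed
  also have "(\<Prod>j=1..r-1. fps_recip (qpoch (zvar j) k)) = ?C"
    using sum_chain_term[of "r - 1" "zvar :: nat \<Rightarrow> 'a zpoly fps" k] assms by simp
  finally have "fps_nth ?S k = fps_nth ?C k"
    unfolding fps_X_power_dvd_iff by simp
  also have "\<dots> = fps_nth (\<Sum>n\<in>?G. summand r n) k"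
    by (rule 1[symmetric])
  also have "\<dots> = (\<Sum>n\<in>?G. fps_nth (summand r n) k)"
    by (rule fps_sum_nth)
  \<comment> \<open>Members of \<open>?G\<close> are families, so the terms dropped have coefficient
    0.\<close>
  also have "\<dots> = (\<Sum>n | n \<in> families r \<and> fps_nth (summand r n :: 'a zpoly fps) k \<noteq> 0. fps_nth (summand r n) k)"
  proof (rule sum.mono_neutral_right[OF fin sub])
    show "\<forall>n\<in>?G - {n \<in> families r. fps_nth (summand r n :: 'a zpoly fps) k \<noteq> 0}. fps_nth (summand r n :: 'a zpoly fps) k = 0"
      using level_chain_family by auto
  qed
  finally show "fps_nth ?S k = (\<Sum>n | n \<in> families r \<and> fps_nth (summand r n :: 'a zpoly fps) k \<noteq> 0. fps_nth (summand r n) k)" .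
qed

end
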